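(* For any nonnegative integers $r,s,t$, the generalized pyramid graph $GP(r,s,t)$ is $e$-positive.
   Context: For nonnegative integers $r,s,t$, the generalized pyramid graph $GP(r,s,t)$ is the finite simple graph on $r+s+t+3$ vertices whose vertex set is the disjoint union $\{a,b,c\}\cup S_{a,b}\cup S_{a,c}\cup S_{b,c}$, where $a,b,c$ are three distinct pairwise nonadjacent vertices, $|S_{a,b}|=r$, $|S_{a,c}|=s$, $|S_{b,c}|=t$, each of $S_{a,b},S_{a,c},S_{b,c}$ is a clique, each vertex of $S_{a,b}$ is adjacent to every other vertex of the graph except $c$, each vertex of $S_{a,c}$ is adjacent to every other vertex of the graph except $b$, and each vertex of $S_{b,c}$ is adjacent to every other vertex of the graph except $a$. (Thus all vertices of $S_{a,b}\cup S_{a,c}\cup S_{b,c}$ are pairwise adjacent.) For a finite simple graph $G=(V,E)$, a proper coloring is a function $\kappa:V\to\{1,2,3,\ldots\}$ with $\kappa(u)\ne\kappa(v)$ whenever $uv\in E$. The chromatic symmetric function of $G$ is $X_G=\sum_{\kappa}\prod_{v\in V}x_{\kappa(v)}$, the sum over all proper colorings $\kappa$ of $G$; it is a homogeneous symmetric function of degree $|V|$ in the variables $x_1,x_2,\ldots$. The elementary symmetric functions are $e_0=1$, $e_i=\sum_{1\le j_1<\cdots<j_i}x_{j_1}\cdots x_{j_i}$ for $i\ge1$, and $e_\lambda=e_{\lambda_1}e_{\lambda_2}\cdots e_{\lambda_k}$ for an integer partition $\lambda=(\lambda_1,\ldots,\lambda_k)$; the set $\{e_\lambda:\lambda\vdash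 n\}$ is a basis of the homogeneous symmetric functions of degree $n$. The graph $G$ is called $e$-positive if $X_G$ is a nonnegative linear combination of the $e_\lambda$. *)

theory Defs
  imports Complex_Main "HOL-Library.Multiset" "HOL-Library.FuncSet"
begin

section \<open>Formal power series in the variables $x_1, x_2, \ldots$\<close>

text \<open>A monomial is encoded by the multiset of its variable indices, with multiplicities as
  exponents; a formal power series is the function sending a monomial to its coefficient.
  Only indices that are at least 1 occur in the series below.\<close>

type_synonym series = "nat multiset \<Rightarrow> real"

text \<open>The formal sum of the monomials \<open>f i\<close> for \<open>i \<in> I\<close>. The index set \<open>I\<close> may be infinite, but
  only finitely many \<open>i\<close> may contribute to any one monomial.\<close>

definition sum_of_monomials :: "'i set \<Rightarrow> ('i \<Rightarrow> nat multiset) \<Rightarrow> series" where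
  "sum_of_monomials I f = (\<lambda>M. real (card {i \<in> I. f i = M}))"

definition series_one :: series where
  "series_one = (\<lambda>M. if M = {#} then 1 else 0)"

definition series_mult :: "series \<Rightarrow> series \<Rightarrow> series" where
  "series_mult F G = (\<lambda>M. \<Sum>(A, B) \<in> {(A, B). A + B = M}. F A * G B)"

lemma finite_factorizations: "finite {(A, B). A + B = (M :: nat multiset)}"
proof -
  have "{A. A \<subseteq># M} \<subseteq> mset ` {xs. set xs \<subseteq> set_mset M \<and> length xs \<le> size M}"
  proof
    fix A assume "A \<in> {A. A \<subseteq># M}"
    then have A: "A \<subseteq># M" by simp
    obtain xs where "mset xs = A" using ex_mset by blast
    moreover from this have "set xs \<subseteq> set_mset M" "length xs \<le> size M"
      using A set_mset_mono[OF A] size_mset_mono[OF A] by auto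
    ultimately show "A \<in> mset ` {xs. set xs \<subseteq> set_mset M \<and> length xs \<le> size M}" by blast
  qed
  then have "finite {A. A \<subseteq># M}"
    by (rule finite_subset) (simp add: finite_lists_length_le)
  then have "finite ({A. A \<subseteq># M} \<times> {A. A \<subseteq># M})" by simp
  then show ?thesis by (rule rev_finite_subset) auto
qed


section \<open>Elementary symmetric functions\<close>

definition elem_sym :: "nat \<Rightarrow> series" where
  "elem_sym i = sum_of_monomials {J. J \<subseteq> {1..} \<and> finite J \<and> card J = i} mset_set"

lemma elem_sym_0: "elem_sym 0 = series_one"
proof
  fix M :: "nat multiset"
  have "{J :: nat set. J \<subseteq> {1..} \<and> finite J \<and> card J = 0 \<and> mset_set J = M} =
      (if M = {#} then {{}} else {})" by auto
  then show "elem_sym 0 M = series_one M"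
    by (simp add: elem_sym_def sum_of_monomials_def series_one_def)
qed

definition elem_sym_list :: "nat list \<Rightarrow> series" where
  "elem_sym_list l = foldr series_mult (map elem_sym l) series_one"

definition integer_partitions :: "nat \<Rightarrow> nat list set" where
  "integer_partitions n = {l. sorted_wrt (\<ge>) l \<and> (\<forall>i \<in> set l. i \<ge> 1) \<and> sum_list l = n}"

lemma finite_integer_partitions: "finite (integer_partitions n)"
proof -
  have len: "length l \<le> sum_list l" if "\<forall>i \<in> set l. i \<ge> 1" for l :: "nat list"
    using that by (induction l) auto
  have "integer_partitions n \<subseteq> {l. set l \<subseteq> {..n} \<and> length l \<le> n}"
    using len by (auto simp: integer_partitions_def intro: member_le_sum_list)
  then show ?thesis by (rule finite_subset) (simp add: finite_lists_length_le)
qed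


section \<open>Chromatic symmetric functions\<close>

text \<open>A graph is a pair of its vertex set and its edge set.\<close>

type_synonym 'a graph = "'a set \<times> 'a set set"

definition finite_simple_graph :: "'a graph \<Rightarrow> bool" where
  "finite_simple_graph = (\<lambda>(V, E). finite V \<and> (\<forall>e \<in> E. e \<subseteq> V \<and> card e = 2))"

text \<open>The extensional function space makes colorings that agree on the vertex set equal, so that
  each coloring is counted once.\<close>

definition proper_colorings :: "'a graph \<Rightarrow> ('a \<Rightarrow> nat) set" where
  "proper_colorings = (\<lambda>(V, E). {\<kappa> \<in> V \<rightarrow>\<^sub>E {1..}. \<forall>u v. {u, v} \<in> E \<longrightarrow> \<kappa> u \<noteq> \<kappa> v})"

definition chromatic_symmetric_function :: "'a graph \<Rightarrow> series" where
  "chromatic_symmetric_function G =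
     sum_of_monomials (proper_colorings G) (\<lambda>\<kappa>. image_mset \<kappa> (mset_set (fst G)))"

lemma finite_colorings_of_monomial:
  assumes "finite (fst G)"
  shows "finite {\<kappa> \<in> proper_colorings G. image_mset \<kappa> (mset_set (fst G)) = M}"
proof -
  have "finite (fst G \<rightarrow>\<^sub>E set_mset M)" using assms by (intro finite_PiE) auto
  then show ?thesis
    by (rule rev_finite_subset)
      (use assms in \<open>auto simp: proper_colorings_def PiE_iff extensional_def split: prod.splits\<close>)
qed

definition e_positive :: "'a graph \<Rightarrow> bool" where
  "e_positive G \<longleftrightarrow> (\<exists>c :: nat list \<Rightarrow> real.
     (\<forall>l \<in> integer_partitions (card (fst G)). c l \<ge> 0) \<and>
     chromatic_symmetric_function G =
       (\<lambda>M. \<Sum>l \<in> integer_partitions (card (fst G)). c l * elem_sym_list l M))"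


section \<open>Generalized pyramid graphs\<close>

datatype gp_vertex = Apex_a | Apex_b | Apex_c | AB nat | AC nat | BC nat

definition GP_verts :: "nat \<Rightarrow> nat \<Rightarrow> nat \<Rightarrow> gp_vertex set" where
  "GP_verts r s t = {Apex_a, Apex_b, Apex_c} \<union> AB ` {..<r} \<union> AC ` {..<s} \<union> BC ` {..<t}"

definition GP_edges :: "nat \<Rightarrow> nat \<Rightarrow> nat \<Rightarrow> gp_vertex set set" where
  "GP_edges r s t =
     {{u, v} | u v. u \<in> AB ` {..<r} \<and> v \<in> GP_verts r s t - {u, Apex_c}} \<union>
     {{u, v} | u v. u \<in> AC ` {..<s} \<and> v \<in> GP_verts r s t - {u, Apex_b}} \<union>
     {{u, v} | u v. u \<in> BC ` {..<t} \<and> v \<in> GP_verts r s t - {u, Apex_a}}"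

definition GP :: "nat \<Rightarrow> nat \<Rightarrow> nat \<Rightarrow> gp_vertex graph" where
  "GP r s t = (GP_verts r s t, GP_edges r s t)"

lemma finite_simple_graph_GP: "finite_simple_graph (GP r s t)"
  by (auto simp: finite_simple_graph_def GP_def GP_verts_def GP_edges_def card_2_iff)

lemma card_GP_verts: "card (GP_verts r s t) = r + s + t + 3"
proof -
  have "card (AB ` {..<r}) = r" "card (AC ` {..<s}) = s" "card (BC ` {..<t}) = t"
    by (simp_all add: card_image inj_on_def)
  then have "card (AB ` {..<r} \<union> AC ` {..<s} \<union> BC ` {..<t}) = r + s + t"
    by (subst card_Un_disjoint; auto simp: card_Un_disjoint)+
  moreover have "GP_verts r s t =
      insert Apex_a (insert Apex_b (insert Apex_c (AB ` {..<r} \<union> AC ` {..<s} \<union> BC ` {..<t})))"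
    by (auto simp: GP_verts_def)
  moreover have "Apex_a \<notin> AB ` {..<r} \<union> AC ` {..<s} \<union> BC ` {..<t}"
    "Apex_b \<notin> AB ` {..<r} \<union> AC ` {..<s} \<union> BC ` {..<t}"
    "Apex_c \<notin> AB ` {..<r} \<union> AC ` {..<s} \<union> BC ` {..<t}" by auto
  ultimately show ?thesis by simp
qed

end

theory Submission imports Defs begin

text \<open>
  A color class of a proper coloring is a stable set, that is, a clique of the complement graph. The
  complement of \<open>GP r s t\<close> is a triangle on the three apices with \<open>r\<close>, \<open>s\<close>, \<open>t\<close> pendant edges at its
  corners. Its cliques are small: vertices, edges and the triangle. Hence the chromatic symmetric
  function \<open>X\<close> has very few kinds of monomials.

  \<^item> If \<open>k\<close> variables have exponent 2 and the others exponent 1, a coloring is an ordered matching of \<open>k\<close>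
  edges of the complement together with a bijection between the remaining vertices and colors. A
  matching has at most three edges, because every edge uses an apex. For \<open>k = 0, 1, 2, 3\<close> there are \<open>1\<close>,
  \<open>N + 3\<close>, \<open>2 p + 2 N\<close>, \<open>6 q\<close> ordered matchings, where \<open>N = r + s + t\<close>, \<open>p = r s + r t + s t\<close> and
  \<open>q = r s t\<close> (\<open>card_colorings_of_doubles\<close>, \<open>ordered_matchings_GP_verts\<close>).

  \<^item> An exponent 3 forces the color class to be the triangle. It uses up all apices, so the other \<open>N\<close>
  exponents are 1 and there are \<open>N!\<close> colorings (\<open>GP_coeff_multiplicity_ge_3\<close>).

  With \<open>n = N + 3\<close>, the products \<open>e\<^sub>n\<close>, \<open>e\<^bsub>n-1\<^esub> e\<^sub>1\<close>, \<open>e\<^bsub>n-2\<^esub> e\<^sub>2\<close>, \<open>e\<^bsub>n-3\<^esub> e\<^sub>3\<close> and \<open>e\<^bsub>n-2\<^esub> e\<^sub>1 e\<^sub>1\<close> involve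
  only these kinds of monomials as well, with binomial coefficients. The coefficients of \<open>X\<close> in terms of
  these products are the solution of a triangular linear system (\<open>coeff_identities\<close>), which gives the
  expansion \<open>chromatic_symmetric_function_GP\<close>. The coefficients of \<open>e\<^bsub>n-2\<^esub> e\<^sub>1 e\<^sub>1\<close> and \<open>e\<^bsub>n-3\<^esub> e\<^sub>3\<close> are
  \<open>N!\<close> and \<open>6 (N - 3)! q\<close>. The other three are nonnegative by elementary inequalities between \<open>N\<close>, \<open>p\<close>
  and \<open>q\<close> (\<open>coeffs_nonneg\<close>).
\<close>

section \<open>The algebra of formal power series\<close>

lemma series_mult_alt: "series_mult F G M = (\<Sum>A | A \<subseteq># M. F A * G (M - A))"
  unfolding series_mult_def
  by (rule sum.reindex_bij_witness[where i = "\<lambda>A. (A, M - A)" and j = fst]) auto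

lemma finite_submultisets: "finite {A. A \<subseteq># (M :: nat multiset)}"
proof -
  have "{A. A \<subseteq># M} = fst ` {(A, B). A + B = M}"
    by (auto simp: image_iff subset_mset.le_iff_add)
  then show ?thesis using finite_factorizations[of M] by simp
qed

lemma series_mult_one_left [simp]: "series_mult series_one F = F"
proof
  fix M
  have "series_mult series_one F M = (\<Sum>A | A \<subseteq># M. if A = {#} then F M else 0)"
    unfolding series_mult_alt series_one_def by (intro sum.cong) auto
  then show "series_mult series_one F M = F M"
    by (simp add: sum.delta[OF finite_submultisets])
qed

lemma series_mult_one_right [simp]: "series_mult F series_one = F"
proof
  fix M
  have "series_mult F series_one M = (\<Sum>A | A \<subseteq># M. if A = M then F M else 0)"
    unfolding series_mult_alt series_one_def
    by (intro sum.cong) (auto simp: Diff_eq_empty_iff_mset subset_mset.antisym_conv)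
  then show "series_mult F series_one M = F M"
    by (simp add: sum.delta[OF finite_submultisets])
qed

text \<open>Both sides are the sum of \<open>F A * G B * H C\<close> over the ordered factorizations of a monomial into
  three factors. This form of associativity and commutativity lets the factors of \<open>elem_sym_list\<close> be permuted.\<close>

lemma series_mult_left_commute:
  "series_mult F (series_mult G H) = series_mult G (series_mult F H)"
proof
  fix M
  let ?fac = "\<lambda>M :: nat multiset. {(A, B). A + B = M}"
  let ?T = "Sigma (?fac M) (\<lambda>p. ?fac (snd p))"
  have expand: "series_mult F' (series_mult G' H) M =
      (\<Sum>(p, q) \<in> ?T. F' (fst p) * (G' (fst q) * H (snd q)))" for F' G'
    unfolding series_mult_def
    by (subst sum.Sigma[symmetric])
      (use finite_factorizations in \<open>auto simp: sum_distrib_left case_prod_beta\<close>)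
  show "series_mult F (series_mult G H) M = series_mult G (series_mult F H) M"
    unfolding expand
    by (rule sum.reindex_bij_witness[where
          i = "\<lambda>(p, q). ((fst q, fst p + snd q), (fst p, snd q))" and
          j = "\<lambda>(p, q). ((fst q, fst p + snd q), (fst p, snd q))"])
      (auto simp: ac_simps)
qed

lemma series_mult_nonzeroD:
  assumes "series_mult F G M \<noteq> 0"
  obtains A B where "M = A + B" "F A \<noteq> 0" "G B \<noteq> 0"
proof -
  from assms obtain A where "A \<subseteq># M" "F A * G (M - A) \<noteq> 0"
    unfolding series_mult_alt by (metis (mono_tags, lifting) mem_Collect_eq sum.neutral)
  then show ?thesis using that[of A "M - A"] by auto
qed

section \<open>The cone spanned by products of elementary symmetric functions\<close>

lemma squarefree_iff: "(\<forall>x. count M x \<le> 1) \<longleftrightarrow> mset_set (set_mset M) = M"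
proof
  assume sqf: "\<forall>x. count M x \<le> 1"
  show "mset_set (set_mset M) = M"
  proof (rule multiset_eqI)
    fix x
    have "count M x = 0 \<or> count M x = 1" using sqf[rule_format, of x] by linarith
    then show "count (mset_set (set_mset M)) x = count M x"
      using not_in_iff[of x M] by (cases "x \<in># M") (simp_all add: count_mset_set' del: count_greater_zero_iff)
  qed
next
  assume "mset_set (set_mset M) = M"
  then show "\<forall>x. count M x \<le> 1"
    by (metis count_mset_set' order_refl zero_le_one)
qed

lemma elem_sym_eq:
  "elem_sym k M = of_bool (0 \<notin># M \<and> (\<forall>x. count M x \<le> 1) \<and> size M = k)"
proof (cases "0 \<notin># M \<and> (\<forall>x. count M x \<le> 1) \<and> size M = k")
  case True
  then have M: "mset_set (set_mset M) = M" by (simp flip: squarefree_iff)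
  then have "card (set_mset M) = k" using True by (metis size_mset_set)
  moreover have "set_mset M \<subseteq> {1..}" using True by (auto simp: Suc_le_eq intro: gr0I)
  ultimately have "{J. (J \<subseteq> {1..} \<and> finite J \<and> card J = k) \<and> mset_set J = M} = {set_mset M}"
  proof (intro equalityI subsetI)
    fix J assume "J \<in> {J. (J \<subseteq> {1..} \<and> finite J \<and> card J = k) \<and> mset_set J = M}"
    then have "J = set_mset M" by (metis (mono_tags, lifting) finite_set_mset_mset_set mem_Collect_eq)
    then show "J \<in> {set_mset M}" by simp
  qed (simp add: M)
  then show ?thesis using True by (simp add: elem_sym_def sum_of_monomials_def)
next
  case False
  have "{J. (J \<subseteq> {1..} \<and> finite J \<and> card J = k) \<and> mset_set J = M} = {}"
  proof (rule ccontr)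
    assume "\<not> ?thesis"
    then obtain J where J: "J \<subseteq> {1..}" "finite J" "card J = k" "M = mset_set J" by blast
    then have "0 \<notin># M \<and> (\<forall>x. count M x \<le> 1) \<and> size M = k" by (auto simp: count_mset_set')
    then show False using False by simp
  qed
  then have "card {J. (J \<subseteq> {1..} \<and> finite J \<and> card J = k) \<and> mset_set J = M} = 0"
    by (simp only: card.empty)
  then show ?thesis
    by (simp only: elem_sym_def sum_of_monomials_def mem_Collect_eq False of_bool_eq of_nat_0)
qed

lemma elem_sym_list_nonzeroD:
  "elem_sym_list l M \<noteq> 0 \<Longrightarrow> 0 \<notin># M \<and> size M = sum_list l"
proof (induction l arbitrary: M)
  case Nil
  then show ?case by (auto simp: elem_sym_list_def series_one_def split: if_splits)
next
  case (Cons k l)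
  then have "series_mult (elem_sym k) (elem_sym_list l) M \<noteq> 0"
    by (simp add: elem_sym_list_def)
  then show ?case
    by (rule series_mult_nonzeroD) (use Cons.IH in \<open>auto simp: elem_sym_eq\<close>)
qed

lemma elem_sym_list_Cons: "elem_sym_list (k # l) = series_mult (elem_sym k) (elem_sym_list l)"
  and elem_sym_list_Nil: "elem_sym_list [] = series_one"
  by (simp_all add: elem_sym_list_def)

lemma elem_sym_list_mset_cong:
  assumes "mset l = mset l'"
  shows "elem_sym_list l = elem_sym_list l'"
proof -
  have "fold (\<lambda>k. series_mult (elem_sym k)) (rev l) = fold (\<lambda>k. series_mult (elem_sym k)) (rev l')"
    using assms
    by (intro fold_multiset_equiv) (auto simp: fun_eq_iff series_mult_left_commute)
  then show ?thesis by (simp add: elem_sym_list_def foldr_conv_fold rev_map fold_map comp_def)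
qed

lemma elem_sym_list_remove_zeros:
  "elem_sym_list (filter (\<lambda>i. i \<noteq> 0) l) = elem_sym_list l"
  by (induction l) (auto simp: elem_sym_list_Cons elem_sym_0)

text \<open>The cone is described by partitions, but a product of elementary symmetric functions in any order
  and with trivial factors \<open>elem_sym 0\<close> lies in it. So expansions can be written with parts such as
  \<open>[3, N]\<close> without asking whether \<open>N\<close> is smaller than 3, or even zero.\<close>

definition e_cone :: "nat \<Rightarrow> series \<Rightarrow> bool" where
  "e_cone n F \<longleftrightarrow> (\<exists>c :: nat list \<Rightarrow> real. (\<forall>l \<in> integer_partitions n. c l \<ge> 0) \<and>
     F = (\<lambda>M. \<Sum>l \<in> integer_partitions n. c l * elem_sym_list l M))"

lemma e_cone_elem_sym_list:
  assumes "sum_list l = n"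
  shows "e_cone n (elem_sym_list l)"
proof -
  let ?p = "rev (sort (filter (\<lambda>i. i \<noteq> 0) l))"
  have eq: "elem_sym_list l = elem_sym_list ?p"
    by (subst elem_sym_list_remove_zeros[symmetric], rule elem_sym_list_mset_cong) simp
  have "sum_list (filter (\<lambda>i. i \<noteq> 0) l) = sum_list l"
    by (induction l) auto
  then have "sum_list ?p = sum_list l"
    by (simp flip: sum_mset_sum_list)
  moreover have "sorted_wrt (\<ge>) ?p" by (simp add: sorted_wrt_rev)
  ultimately have p: "?p \<in> integer_partitions n"
    using assms by (auto simp: integer_partitions_def Suc_le_eq)
  have "elem_sym_list l M =
      (\<Sum>q \<in> integer_partitions n. of_bool (q = ?p) * elem_sym_list q M)" for M
    unfolding eq using p by (simp add: finite_integer_partitions Int_absorb1)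
  then show ?thesis
    unfolding e_cone_def by (intro exI[of _ "\<lambda>q. of_bool (q = ?p)"]) auto
qed

lemma e_cone_add:
  assumes "e_cone n F" "e_cone n G"
  shows "e_cone n (\<lambda>M. F M + G M)"
proof -
  from assms obtain c d where "\<forall>l \<in> integer_partitions n. c l \<ge> 0"
    "F = (\<lambda>M. \<Sum>l \<in> integer_partitions n. c l * elem_sym_list l M)"
    "\<forall>l \<in> integer_partitions n. d l \<ge> 0"
    "G = (\<lambda>M. \<Sum>l \<in> integer_partitions n. d l * elem_sym_list l M)"
    unfolding e_cone_def by blast
  then show ?thesis
    unfolding e_cone_def
    by (intro exI[of _ "\<lambda>l. c l + d l"]) (auto simp: sum.distrib distrib_right)
qed

lemma e_cone_scale:
  assumes "e_cone n F" "a \<ge> 0"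
  shows "e_cone n (\<lambda>M. a * F M)"
proof -
  from assms obtain c where "\<forall>l \<in> integer_partitions n. c l \<ge> 0"
    "F = (\<lambda>M. \<Sum>l \<in> integer_partitions n. c l * elem_sym_list l M)"
    unfolding e_cone_def by blast
  then show ?thesis
    unfolding e_cone_def using assms(2)
    by (intro exI[of _ "\<lambda>l. a * c l"]) (auto simp: sum_distrib_left ac_simps)
qed

section \<open>Coefficients of products of elementary symmetric functions\<close>

lemma elem_sym_mult_coeff:
  assumes "0 \<notin># M"
  shows "series_mult (elem_sym k) F M = (\<Sum>J | J \<subseteq> set_mset M \<and> card J = k. F (M - mset_set J))"
proof -
  have fin: "finite J" if "J \<subseteq> set_mset M" for J using that by (rule finite_subset) simp
  have "series_mult (elem_sym k) F M =
      (\<Sum>A | A \<subseteq># M \<and> (\<forall>x. count A x \<le> 1) \<and> size A = k. F (M - A))"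
    unfolding series_mult_alt using finite_submultisets[of M]  assms
    by (intro sum.mono_neutral_cong_right) (auto simp: elem_sym_eq dest: mset_subset_eqD)
  also have "\<dots> = (\<Sum>J | J \<subseteq> set_mset M \<and> card J = k. F (M - mset_set J))"
  proof (rule sum.reindex_bij_witness[where i = mset_set and j = set_mset])
    fix A assume A: "A \<in> {A. A \<subseteq># M \<and> (\<forall>x. count A x \<le> 1) \<and> size A = k}"
    then have eq: "mset_set (set_mset A) = A" by (simp flip: squarefree_iff)
    then show "mset_set (set_mset A) = A" .
    show "set_mset A \<in> {J. J \<subseteq> set_mset M \<and> card J = k}"
      using A eq by (auto dest: mset_subset_eqD) (metis size_mset_set)
    show "F (M - mset_set (set_mset A)) = F (M - A)" by (simp add: eq)
  next
    fix J assume J: "J \<in> {J. J \<subseteq> set_mset M \<and> card J = k}"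
    show "set_mset (mset_set J) = J" using fin J by simp
    show "mset_set J \<in> {A. A \<subseteq># M \<and> (\<forall>x. count A x \<le> 1) \<and> size A = k}"
      using J fin by (auto simp: subseteq_mset_def count_mset_set' Suc_le_eq)
  qed
  finally show ?thesis .
qed

lemma elem_sym_1_mult_coeff:
  assumes "0 \<notin># M"
  shows "series_mult (elem_sym 1) F M = (\<Sum>x \<in> set_mset M. F (M - {#x#}))"
  unfolding elem_sym_mult_coeff[OF assms]
  by (rule sum.reindex_bij_witness[where i = "\<lambda>x. {x}" and j = the_elem])
    (auto simp: card_1_singleton_iff)

lemma elem_sym_elem_sym_eq_0:
  assumes "count M x \<ge> 3"
  shows "series_mult (elem_sym k) (elem_sym l) M = 0"
proof (rule ccontr)
  assume "\<not> ?thesis"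
  then show False
  proof (rule series_mult_nonzeroD)
    fix A B assume AB: "M = A + B" "elem_sym k A \<noteq> 0" "elem_sym l B \<noteq> 0"
    then have "count A x \<le> 1" "count B x \<le> 1" by (auto simp: elem_sym_eq)
    with assms AB show False by simp
  qed
qed

lemma card_sets_between:
  assumes "finite U" "finite D" "D \<inter> U = {}"
  shows "card {J. D \<subseteq> J \<and> J \<subseteq> D \<union> U \<and> card J = k} =
    (if card D \<le> k then card U choose (k - card D) else 0)"
proof (cases "card D \<le> k")
  case True
  have "bij_betw (\<lambda>J. D \<union> J) {J. J \<subseteq> U \<and> card J = k - card D}
      {J. D \<subseteq> J \<and> J \<subseteq> D \<union> U \<and> card J = k}"
  proof (rule bij_betw_byWitness[where f' = "\<lambda>J. J - D"])
    show "(\<union>) D ` {J. J \<subseteq> U \<and> card J = k - card D} \<subseteq>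
        {J. D \<subseteq> J \<and> J \<subseteq> D \<union> U \<and> card J = k}"
      using assms True
      by (auto, subst card_Un_disjoint) (auto intro: finite_subset)
    show "(\<lambda>J. J - D) ` {J. D \<subseteq> J \<and> J \<subseteq> D \<union> U \<and> card J = k} \<subseteq>
        {J. J \<subseteq> U \<and> card J = k - card D}"
      using assms by (auto simp: card_Diff_subset)
  qed (use assms in auto)
  then show ?thesis
    using True n_subsets[OF assms(1)] by (auto dest: bij_betw_same_card)
next
  case False
  have "card D \<le> card J" if "D \<subseteq> J" "J \<subseteq> D \<union> U" for J
    using that assms by (meson card_mono finite_UnI finite_subset)
  then have "{J. D \<subseteq> J \<and> J \<subseteq> D \<union> U \<and> card J = k} = {}"
    using False by blast
  then show ?thesis using False by (simp only: card.empty if_False)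
qed

text \<open>A factorization into two squarefree monomials puts one copy of every doubled variable into each
  factor. It is determined by the variables in \<open>U\<close> that go to the first factor.\<close>

lemma elem_sym_elem_sym_coeff:
  assumes fin: "finite U" "finite D" and disj: "D \<inter> U = {}" and "0 \<notin> D \<union> U"
    and size: "2 * card D + card U = k + l"
  shows "series_mult (elem_sym k) (elem_sym l) (mset_set D + mset_set D + mset_set U) =
    (if card D \<le> k then real (card U choose (k - card D)) else 0)"
proof -
  let ?M = "mset_set D + mset_set D + mset_set U"
  have "series_mult (elem_sym k) (elem_sym l) ?M =
      (\<Sum>J | J \<subseteq> D \<union> U \<and> card J = k. elem_sym l (?M - mset_set J))"
    using assms by (subst elem_sym_mult_coeff) auto
  also have "\<dots> = (\<Sum>J | J \<subseteq> D \<union> U \<and> card J = k. of_bool (D \<subseteq> J))"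
  proof (rule sum.cong)
    fix J assume J: "J \<in> {J. J \<subseteq> D \<union> U \<and> card J = k}"
    then have finJ: "finite J" using fin by (auto intro: finite_subset)
    have "mset_set J \<subseteq># ?M"
      using J fin finJ disj by (auto simp: subseteq_mset_def count_mset_set')
    then have sz: "size (?M - mset_set J) = l"
      using J size by (simp add: size_Diff_submset)
    have "(\<forall>x. count (?M - mset_set J) x \<le> 1) \<longleftrightarrow> D \<subseteq> J"
      using J fin finJ disj by (auto simp: count_mset_set' split: if_splits)
    moreover have "0 \<notin># ?M - mset_set J"
      using assms by (auto dest: in_diffD)
    ultimately show "elem_sym l (?M - mset_set J) = of_bool (D \<subseteq> J)"
      using sz by (simp add: elem_sym_eq)
  qed simp
  also have "\<dots> = real (card {J. D \<subseteq> J \<and> J \<subseteq> D \<union> U \<and> card J = k})"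
    using fin by (simp add: sum.If_cases of_bool_def Int_def conj_ac)
  finally show ?thesis by (simp add: card_sets_between[OF fin disj])
qed

text \<open>Taking one copy away from a variable in \<open>D\<close> moves it from \<open>D\<close> to \<open>U\<close>; taking away a variable in \<open>U\<close>
  deletes it. Both leave a monomial of the shape treated by the previous lemma.\<close>

lemma elem_sym_1_1_coeff:
  assumes fin: "finite U" "finite D" and disj: "D \<inter> U = {}" and zero: "0 \<notin> D \<union> U"
    and size: "2 * card D + card U = l + 2"
  shows "series_mult (elem_sym 1) (series_mult (elem_sym 1) (elem_sym l))
      (mset_set D + mset_set D + mset_set U) =
    (if card D = 0 then real (card U * (card U - 1)) else
     if card D = 1 then 2 * real (card U) + 1 else if card D = 2 then 2 else 0)"
proof -
  let ?M = "mset_set D + mset_set D + mset_set U"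
  let ?F = "series_mult (elem_sym 1) (elem_sym l)"
  have inD: "?F (?M - {#x#}) =
      (if card D \<le> 2 then real ((card U + 1) choose (2 - card D)) else 0)" if x: "x \<in> D" for x
  proof -
    have eq: "?M - {#x#} = mset_set (D - {x}) + mset_set (D - {x}) + mset_set (insert x U)"
      using x fin disj by (auto simp: multiset_eq_iff count_mset_set')
    have pos: "card D > 0" using x fin by (auto simp: card_gt_0_iff)
    have "x \<notin> U" using x disj by auto
    then have "?F (?M - {#x#}) =
        (if card (D - {x}) \<le> 1 then real (card (insert x U) choose (1 - card (D - {x}))) else 0)"
      unfolding eq using fin disj zero size x pos
      by (intro elem_sym_elem_sym_coeff) auto
    moreover have "1 - card (D - {x}) = 2 - card D" using pos x fin by simp
    ultimately show ?thesis using fin x \<open>x \<notin> U\<close> pos by (auto simp: le_diff_conv)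
  qed
  have inU: "?F (?M - {#x#}) =
      (if card D \<le> 1 then real ((card U - 1) choose (1 - card D)) else 0)" if x: "x \<in> U" for x
  proof -
    have eq: "?M - {#x#} = mset_set D + mset_set D + mset_set (U - {x})"
      using x fin disj by (auto simp: multiset_eq_iff count_mset_set')
    have pos: "card U > 0" using x fin by (auto simp: card_gt_0_iff)
    show ?thesis
      unfolding eq using fin disj zero size x pos
      by (subst elem_sym_elem_sym_coeff) auto
  qed
  have "series_mult (elem_sym 1) ?F ?M = (\<Sum>x \<in> D \<union> U. ?F (?M - {#x#}))"
    using fin zero by (subst elem_sym_1_mult_coeff) auto
  also have "\<dots> = (\<Sum>x \<in> D. ?F (?M - {#x#})) + (\<Sum>x \<in> U. ?F (?M - {#x#}))"
    using fin disj by (simp add: sum.union_disjoint)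
  also have "\<dots> = real (card D) * (if card D \<le> 2 then real ((card U + 1) choose (2 - card D)) else 0) +
      real (card U) * (if card D \<le> 1 then real ((card U - 1) choose (1 - card D)) else 0)"
    by (simp only: sum.cong[OF refl inD] sum.cong[OF refl inU] sum_constant)
  finally show ?thesis by (auto simp: le_Suc_eq numeral_2_eq_2 numeral_3_eq_3)
qed

lemma elem_sym_1_1_nonzeroD:
  assumes "series_mult (elem_sym 1) (series_mult (elem_sym 1) (elem_sym l)) M \<noteq> 0"
  obtains x y B where "M = {#x#} + {#y#} + B" "\<And>z. count B z \<le> 1"
proof -
  from assms obtain A B where M: "M = A + B" "elem_sym 1 A \<noteq> 0"
    "series_mult (elem_sym 1) (elem_sym l) B \<noteq> 0" by (rule series_mult_nonzeroD)
  from M(3) obtain A' B' where B: "B = A' + B'" "elem_sym 1 A' \<noteq> 0" "elem_sym l B' \<noteq> 0"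
    by (rule series_mult_nonzeroD)
  from M(2) obtain x where "A = {#x#}" by (auto simp: elem_sym_eq size_1_singleton_mset)
      (metis One_nat_def size_1_singleton_mset)
  moreover from B(2) obtain y where "A' = {#y#}" by (auto simp: elem_sym_eq)
      (metis One_nat_def size_1_singleton_mset)
  ultimately show ?thesis
    using that[of x y B'] M(1) B(1,3) by (auto simp: elem_sym_eq ac_simps)
qed

lemma elem_sym_1_1_coeff_triple:
  assumes "finite U" "d \<notin> U" "0 \<notin> insert d U" "card U + 1 = l"
  shows "series_mult (elem_sym 1) (series_mult (elem_sym 1) (elem_sym l))
      (replicate_mset 3 d + mset_set U) = 1"
proof -
  let ?M = "replicate_mset 3 d + mset_set U"
  let ?F = "series_mult (elem_sym 1) (elem_sym l)"
  have "series_mult (elem_sym 1) ?F ?M = (\<Sum>x \<in> insert d U. ?F (?M - {#x#}))"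
    using assms by (subst elem_sym_1_mult_coeff) auto
  also have "\<dots> = ?F (?M - {#d#}) + (\<Sum>x \<in> U. ?F (?M - {#x#}))"
    using assms by simp
  also have "(\<Sum>x \<in> U. ?F (?M - {#x#})) = 0"
    using assms by (intro sum.neutral ballI elem_sym_elem_sym_eq_0[of _ d]) auto
  also have "?M - {#d#} = mset_set {d} + mset_set {d} + mset_set U"
    by (simp add: numeral_3_eq_3)
  also have "?F \<dots> = 1"
    using assms by (subst elem_sym_elem_sym_coeff) auto
  finally show ?thesis by simp
qed

section \<open>Colorings with prescribed color multiplicities\<close>

definition stable_set :: "'a set set \<Rightarrow> 'a set \<Rightarrow> bool" where
  "stable_set E W \<longleftrightarrow> (\<forall>u \<in> W. \<forall>v \<in> W. {u, v} \<notin> E)"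

text \<open>Only edges inside the vertex set matter, so that \<open>V\<close> can shrink while the edge set \<open>E\<close> of the
  ambient graph stays. The range of colors is left open because \<open>M\<close> prescribes it.\<close>

definition colorings_of :: "'a set set \<Rightarrow> 'a set \<Rightarrow> nat multiset \<Rightarrow> ('a \<Rightarrow> nat) set" where
  "colorings_of E V M = {\<kappa> \<in> V \<rightarrow>\<^sub>E UNIV.
     (\<forall>u \<in> V. \<forall>v \<in> V. {u, v} \<in> E \<longrightarrow> \<kappa> u \<noteq> \<kappa> v) \<and> image_mset \<kappa> (mset_set V) = M}"

lemma chromatic_symmetric_function_coeff:
  assumes "finite_simple_graph (V, E)" "0 \<notin># M"
  shows "chromatic_symmetric_function (V, E) M = real (card (colorings_of E V M))"
proof -
  have "u \<in> V \<and> v \<in> V" if "{u, v} \<in> E" for u v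
    using assms(1) that by (auto simp: finite_simple_graph_def)
  moreover have "\<kappa> v \<ge> 1" if "image_mset \<kappa> (mset_set V) = M" "v \<in> V" for \<kappa> v
  proof -
    have "\<kappa> v \<in># M" using that assms(1) by (auto simp: finite_simple_graph_def)
    then show ?thesis using assms(2) by (cases "\<kappa> v") auto
  qed
  ultimately have "{\<kappa> \<in> proper_colorings (V, E). image_mset \<kappa> (mset_set V) = M} = colorings_of E V M"
    unfolding proper_colorings_def colorings_of_def by (fastforce simp: PiE_iff)
  then show ?thesis
    by (simp add: chromatic_symmetric_function_def sum_of_monomials_def)
qed

lemma chromatic_symmetric_function_nonzeroD:
  assumes "finite V" "chromatic_symmetric_function (V, E) M \<noteq> 0"
  shows "0 \<notin># M \<and> size M = card V"
proof -
  have "{\<kappa> \<in> proper_colorings (V, E). image_mset \<kappa> (mset_set V) = M} \<noteq> {}"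
    using assms(2)
    by (auto simp: chromatic_symmetric_function_def sum_of_monomials_def simp del: Collect_empty_eq)
  then obtain \<kappa> where "\<kappa> \<in> V \<rightarrow>\<^sub>E {1..}" "image_mset \<kappa> (mset_set V) = M"
    by (auto simp: proper_colorings_def)
  then show ?thesis using assms(1) by (fastforce simp: PiE_iff)
qed

text \<open>A coloring amounts to the class of one color, which is a stable set, together with a coloring of
  the remaining vertices by the remaining colors. All coefficient computations reduce to
  this recursion.\<close>

lemma colorings_of_color_class:
  assumes fin: "finite V" and d: "d \<notin># M"
  shows "card (colorings_of E V (replicate_mset m d + M)) =
    (\<Sum>W | W \<subseteq> V \<and> card W = m \<and> stable_set E W. card (colorings_of E (V - W) M))"
proof -
  let ?Ws = "{W. W \<subseteq> V \<and> card W = m \<and> stable_set E W}"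
  let ?f = "\<lambda>\<kappa>. ({v \<in> V. \<kappa> v = d}, restrict \<kappa> (V - {v \<in> V. \<kappa> v = d}))"
  let ?g = "\<lambda>(W, \<kappa>). \<lambda>v. if v \<in> W then d else \<kappa> v"
  have split: "mset_set V = mset_set W + mset_set (V - W)" if "W \<subseteq> V" for W
    using that fin by (auto simp: multiset_eq_iff count_mset_set' dest: finite_subset)
  have const: "image_mset \<kappa> (mset_set W) = replicate_mset (card W) d"
    if "finite W" "\<And>v. v \<in> W \<Longrightarrow> \<kappa> v = d" for \<kappa> :: "'a \<Rightarrow> nat" and W
    using that by (induction W rule: finite_induct) auto
  have avoid: "\<kappa> v \<noteq> d" if "\<kappa> \<in> colorings_of E (V - W) M" "v \<in> V - W" for \<kappa> W v
    using that d fin by (auto simp: colorings_of_def)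
  have "bij_betw ?f (colorings_of E V (replicate_mset m d + M))
      (Sigma ?Ws (\<lambda>W. colorings_of E (V - W) M))"
  proof (rule bij_betw_byWitness[where f' = ?g])
    show "\<forall>\<kappa> \<in> colorings_of E V (replicate_mset m d + M). ?g (?f \<kappa>) = \<kappa>"
      by (auto simp: colorings_of_def fun_eq_iff PiE_iff extensional_def)
    show "\<forall>p \<in> Sigma ?Ws (\<lambda>W. colorings_of E (V - W) M). ?f (?g p) = p"
    proof
      fix p assume "p \<in> Sigma ?Ws (\<lambda>W. colorings_of E (V - W) M)"
      then obtain W \<kappa> where p: "p = (W, \<kappa>)" and W: "W \<subseteq> V"
        and \<kappa>: "\<kappa> \<in> colorings_of E (V - W) M" by blast
      have eq: "{v \<in> V. (if v \<in> W then d else \<kappa> v) = d} = W"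
        using W avoid[OF \<kappa>] by auto
      have "\<kappa> v = undefined" if "v \<notin> V - W" for v
        using that \<kappa> by (auto simp: colorings_of_def PiE_iff extensional_def)
      then show "?f (?g p) = p"
        by (auto simp: p eq fun_eq_iff)
    qed
    show "?f ` colorings_of E V (replicate_mset m d + M) \<subseteq>
        Sigma ?Ws (\<lambda>W. colorings_of E (V - W) M)"
    proof (rule image_subsetI)
      fix \<kappa> assume \<kappa>: "\<kappa> \<in> colorings_of E V (replicate_mset m d + M)"
      define W where "W = {v \<in> V. \<kappa> v = d}"
      have W: "W \<subseteq> V" "finite W" using fin by (auto simp: W_def)
      have *: "replicate_mset (card W) d + image_mset \<kappa> (mset_set (V - W)) = replicate_mset m d + M"
        using \<kappa> split[OF W(1)] const[OF W(2), of \<kappa>] by (auto simp: colorings_of_def W_def)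
      have "d \<notin># image_mset \<kappa> (mset_set (V - W))"
        using fin by (auto simp: W_def)
      then have zero: "count (image_mset \<kappa> (mset_set (V - W))) d = 0" "count M d = 0"
        using d by (simp_all only: not_in_iff)
      have "card W = m"
        using arg_cong[OF *, of "\<lambda>N. count N d"] zero
        by (simp only: count_union count_replicate_mset if_True refl add_0_right)
      moreover from this have eq: "image_mset \<kappa> (mset_set (V - W)) = M" using * by simp
      have "image_mset (restrict \<kappa> (V - W)) (mset_set (V - W)) = M"
        using eq fin by (metis (no_types, lifting) finite_Diff elem_mset_set image_mset_cong restrict_apply')
      moreover have "stable_set E W"
        using \<kappa> unfolding stable_set_def W_def colorings_of_def by fastforce
      ultimately show "?f \<kappa> \<in> Sigma ?Ws (\<lambda>W. colorings_of E (V - W) M)"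
        using \<kappa> W by (auto simp: colorings_of_def simp flip: W_def)
    qed
    show "?g ` Sigma ?Ws (\<lambda>W. colorings_of E (V - W) M) \<subseteq>
        colorings_of E V (replicate_mset m d + M)"
    proof (rule image_subsetI)
      fix p assume "p \<in> Sigma ?Ws (\<lambda>W. colorings_of E (V - W) M)"
      then obtain W \<kappa> where p: "p = (W, \<kappa>)" and W: "W \<subseteq> V" "stable_set E W" "m = card W"
        and \<kappa>: "\<kappa> \<in> colorings_of E (V - W) M" by blast
      let ?\<kappa> = "\<lambda>v. if v \<in> W then d else \<kappa> v"
      have "finite W" using W fin by (auto dest: finite_subset)
      have "image_mset ?\<kappa> (mset_set (V - W)) = image_mset \<kappa> (mset_set (V - W))"
        using fin by (intro image_mset_cong) auto
      then have "image_mset ?\<kappa> (mset_set V) = replicate_mset (card W) d + M"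
        using split[OF W(1)] const[OF \<open>finite W\<close>, of ?\<kappa>] \<kappa> by (simp add: colorings_of_def)
      moreover have "?\<kappa> u \<noteq> ?\<kappa> v" if "u \<in> V" "v \<in> V" "{u, v} \<in> E" for u v
        using that W(2) \<kappa> avoid[OF \<kappa>]
        by (auto simp: stable_set_def colorings_of_def)
      ultimately show "?g p \<in> colorings_of E V (replicate_mset m d + M)"
        using \<kappa> W(1) by (auto simp: p W(3) colorings_of_def PiE_iff extensional_def)
    qed
  qed
  then have "card (colorings_of E V (replicate_mset m d + M)) =
      card (Sigma ?Ws (\<lambda>W. colorings_of E (V - W) M))" by (rule bij_betw_same_card)
  also have "\<dots> = (\<Sum>W \<in> ?Ws. card (colorings_of E (V - W) M))"
  proof (rule card_SigmaI)
    show "finite ?Ws" using fin by simp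
    have "finite (colorings_of E V' M')" if "finite V'" for V' M'
    proof -
      have "finite (V' \<rightarrow>\<^sub>E set_mset M')" using that by (intro finite_PiE) auto
      then show ?thesis
        by (rule rev_finite_subset) (use that in \<open>auto simp: colorings_of_def PiE_def Pi_def\<close>)
    qed
    then show "\<forall>W \<in> ?Ws. finite (colorings_of E (V - W) M)" using fin by simp
  qed
  finally show ?thesis .
qed

text \<open>A stable pair is an edge of the complement graph, so these are the matchings of the complement
  with an order on their \<open>k\<close> edges.\<close>

primrec ordered_matchings :: "nat \<Rightarrow> 'a set set \<Rightarrow> 'a set \<Rightarrow> nat" where
  "ordered_matchings 0 E V = 1"
| "ordered_matchings (Suc k) E V =
     (\<Sum>W | W \<subseteq> V \<and> card W = 2 \<and> stable_set E W. ordered_matchings k E (V - W))"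

lemma card_colorings_of_squarefree:
  assumes "finite U" "finite V" "card V = card U" "\<And>v. {v} \<notin> E"
  shows "card (colorings_of E V (mset_set U)) = fact (card U)"
  using assms(1,2,3)
proof (induction U arbitrary: V)
  case empty
  then have "colorings_of E V (mset_set {}) = {\<lambda>_. undefined}"
    by (auto simp: colorings_of_def)
  then show ?case by simp
next
  case (insert d U)
  have singles: "{W. W \<subseteq> V \<and> card W = 1 \<and> stable_set E W} = (\<lambda>v. {v}) ` V"
    using assms(4) by (auto simp: card_1_singleton_iff stable_set_def)
  have "mset_set (insert d U) = replicate_mset 1 d + mset_set U" using insert by simp
  then have "card (colorings_of E V (mset_set (insert d U))) =
      (\<Sum>W \<in> (\<lambda>v. {v}) ` V. card (colorings_of E (V - W) (mset_set U)))"
    using insert colorings_of_color_class[of V d "mset_set U" E 1] by (simp add: singles[simplified])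
  also have "\<dots> = (\<Sum>v \<in> V. fact (card U))"
    using insert by (subst sum.reindex) (auto intro!: sum.cong)
  finally show ?case using insert by simp
qed

text \<open>The classes of the colors in \<open>D\<close> form an ordered matching of the complement graph, and the colors
  in \<open>U\<close> are distributed bijectively over the vertices that are left.\<close>

lemma card_colorings_of_doubles:
  assumes "finite D" "finite U" "D \<inter> U = {}" "finite V" "card V = 2 * card D + card U"
    "\<And>v. {v} \<notin> E"
  shows "card (colorings_of E V (mset_set D + mset_set D + mset_set U)) =
    ordered_matchings (card D) E V * fact (card U)"
  using assms(1,3,4,5)
proof (induction D arbitrary: V)
  case empty
  then show ?case by (simp add: card_colorings_of_squarefree[OF assms(2)] assms(6))
next
  case (insert d D)
  let ?M = "mset_set D + mset_set D + mset_set U"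
  have IH: "card (colorings_of E (V - W) ?M) = ordered_matchings (card D) E (V - W) * fact (card U)"
    if "W \<subseteq> V" "card W = 2" for W
  proof (rule insert.IH)
    show "card (V - W) = 2 * card D + card U"
      using that insert by (simp add: card_Diff_subset finite_subset[OF that(1)])
  qed (use insert in auto)
  have "mset_set (insert d D) + mset_set (insert d D) + mset_set U = replicate_mset 2 d + ?M"
    using insert by (simp add: numeral_2_eq_2)
  then have "card (colorings_of E V (mset_set (insert d D) + mset_set (insert d D) + mset_set U)) =
      (\<Sum>W | W \<subseteq> V \<and> card W = 2 \<and> stable_set E W. card (colorings_of E (V - W) ?M))"
    using insert assms(2) by (simp only:) (rule colorings_of_color_class, auto)
  also have "\<dots> = (\<Sum>W | W \<subseteq> V \<and> card W = 2 \<and> stable_set E W.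
      ordered_matchings (card D) E (V - W) * fact (card U))"
    by (intro sum.cong) (auto simp: IH)
  finally show ?case using insert by (simp add: sum_distrib_right)
qed

section \<open>Stable sets of generalized pyramid graphs\<close>

text \<open>The complement of a generalized pyramid graph is the triangle of its apices with pendant edges
  attached: the vertices of each of the three cliques hang at the apex that they are not adjacent to.\<close>

definition GP_pendant_pairs :: "nat \<Rightarrow> nat \<Rightarrow> nat \<Rightarrow> gp_vertex set set" where
  "GP_pendant_pairs r s t =
     (\<lambda>i. {Apex_a, BC i}) ` {..<t} \<union> (\<lambda>i. {Apex_b, AC i}) ` {..<s} \<union> (\<lambda>i. {Apex_c, AB i}) ` {..<r}"

lemma GP_edgesI:
  "i < r \<Longrightarrow> v \<in> GP_verts r s t - {AB i, Apex_c} \<Longrightarrow> {AB i, v} \<in> GP_edges r s t"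
  "i < s \<Longrightarrow> v \<in> GP_verts r s t - {AC i, Apex_b} \<Longrightarrow> {AC i, v} \<in> GP_edges r s t"
  "i < t \<Longrightarrow> v \<in> GP_verts r s t - {BC i, Apex_a} \<Longrightarrow> {BC i, v} \<in> GP_edges r s t"
  unfolding GP_edges_def
  by (rule UnI1, rule UnI1, rule CollectI, rule exI[of _ "AB i"], rule exI[of _ v], simp)
    (rule UnI1, rule UnI2, rule CollectI, rule exI[of _ "AC i"], rule exI[of _ v], simp,
     rule UnI2, rule CollectI, rule exI[of _ "BC i"], rule exI[of _ v], simp)

lemma GP_edgeD:
  assumes "{u, v} \<in> GP_edges r s t"
  shows "u \<noteq> v \<and> ((\<exists>i. u = AB i) \<and> v \<noteq> Apex_c \<or> (\<exists>i. v = AB i) \<and> u \<noteq> Apex_c \<or>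
    (\<exists>i. u = AC i) \<and> v \<noteq> Apex_b \<or> (\<exists>i. v = AC i) \<and> u \<noteq> Apex_b \<or>
    (\<exists>i. u = BC i) \<and> v \<noteq> Apex_a \<or> (\<exists>i. v = BC i) \<and> u \<noteq> Apex_a)"
  using assms by (auto simp: GP_edges_def doubleton_eq_iff)

lemma GP_no_loop: "{v} \<notin> GP_edges r s t"
  using GP_edgeD[of v v] by auto

text \<open>These are the cliques of a triangle with pendant edges.\<close>

lemma GP_stable_sets:
  "W \<subseteq> GP_verts r s t \<and> stable_set (GP_edges r s t) W \<longleftrightarrow>
   W \<subseteq> {Apex_a, Apex_b, Apex_c} \<or> (\<exists>P \<in> GP_pendant_pairs r s t. W \<subseteq> P)"
  (is "?L \<longleftrightarrow> ?R")
proof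
  assume L: ?L
  then have sub: "W \<subseteq> GP_verts r s t"
    and st: "{u, v} \<notin> GP_edges r s t" if "u \<in> W" "v \<in> W" for u v
    using that by (auto simp: stable_set_def)
  have AB: "W \<subseteq> {Apex_c, AB i} \<and> i < r" if "AB i \<in> W" for i
  proof -
    have i: "i < r" using that sub by (auto simp: GP_verts_def)
    have "{AB i, v} \<in> GP_edges r s t" if "v \<in> W" "v \<noteq> AB i" "v \<noteq> Apex_c" for v
      using i that sub by (intro GP_edgesI) auto
    then show ?thesis using i st[OF that] by blast
  qed
  have AC: "W \<subseteq> {Apex_b, AC i} \<and> i < s" if "AC i \<in> W" for i
  proof -
    have i: "i < s" using that sub by (auto simp: GP_verts_def)
    have "{AC i, v} \<in> GP_edges r s t" if "v \<in> W" "v \<noteq> AC i" "v \<noteq> Apex_b" for v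
      using i that sub by (intro GP_edgesI) auto
    then show ?thesis using i st[OF that] by blast
  qed
  have BC: "W \<subseteq> {Apex_a, BC i} \<and> i < t" if "BC i \<in> W" for i
  proof -
    have i: "i < t" using that sub by (auto simp: GP_verts_def)
    have "{BC i, v} \<in> GP_edges r s t" if "v \<in> W" "v \<noteq> BC i" "v \<noteq> Apex_a" for v
      using i that sub by (intro GP_edgesI) auto
    then show ?thesis using i st[OF that] by blast
  qed
  show ?R
  proof (cases "W \<subseteq> {Apex_a, Apex_b, Apex_c}")
    case False
    then obtain v where "v \<in> W" "v \<notin> {Apex_a, Apex_b, Apex_c}" by blast
    then show ?thesis
      using AB AC BC by (cases v) (fastforce simp: GP_pendant_pairs_def)+
  qed simp
next
  assume ?R
  then show ?L
  proof
    assume "W \<subseteq> {Apex_a, Apex_b, Apex_c}"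
    then show ?thesis
      by (auto simp: stable_set_def GP_verts_def dest!: GP_edgeD)
  next
    assume "\<exists>P \<in> GP_pendant_pairs r s t. W \<subseteq> P"
    then obtain P where P: "P \<in> GP_pendant_pairs r s t" "W \<subseteq> P" by blast
    from P(1) have "P \<subseteq> GP_verts r s t \<and> stable_set (GP_edges r s t) P"
      by (auto simp: stable_set_def GP_pendant_pairs_def GP_verts_def dest!: GP_edgeD)
    then show ?thesis using P(2) by (auto simp: stable_set_def)
  qed
qed

lemma GP_stable_pairs:
  assumes "Y \<subseteq> GP_verts r s t"
  shows "{W. W \<subseteq> Y \<and> card W = 2 \<and> stable_set (GP_edges r s t) W} =
    {W \<in> {{Apex_a, Apex_b}, {Apex_a, Apex_c}, {Apex_b, Apex_c}} \<union> GP_pendant_pairs r s t. W \<subseteq> Y}"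
proof -
  have apex: "W \<subseteq> {Apex_a, Apex_b, Apex_c} \<and> card W = 2 \<longleftrightarrow>
      W \<in> {{Apex_a, Apex_b}, {Apex_a, Apex_c}, {Apex_b, Apex_c}}" for W
    by (auto simp: card_2_iff insert_commute)
  have pair: "card P = 2" "finite P" if "P \<in> GP_pendant_pairs r s t" for P
    using that by (auto simp: GP_pendant_pairs_def)
  have pendant: "(\<exists>P \<in> GP_pendant_pairs r s t. W \<subseteq> P) \<and> card W = 2 \<longleftrightarrow>
      W \<in> GP_pendant_pairs r s t" for W
  proof
    assume "(\<exists>P \<in> GP_pendant_pairs r s t. W \<subseteq> P) \<and> card W = 2"
    then obtain P where "P \<in> GP_pendant_pairs r s t" "W \<subseteq> P" "card W = 2" by blast
    then show "W \<in> GP_pendant_pairs r s t"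
      using card_subset_eq[of P W] pair[of P] by simp
  qed (use pair in blast)
  have "W \<subseteq> Y \<and> card W = 2 \<and> stable_set (GP_edges r s t) W \<longleftrightarrow>
      W \<in> {{Apex_a, Apex_b}, {Apex_a, Apex_c}, {Apex_b, Apex_c}} \<union> GP_pendant_pairs r s t \<and> W \<subseteq> Y" for W
    unfolding Un_iff apex[symmetric] pendant[symmetric]
    using GP_stable_sets[of W r s t] subset_trans[OF _ assms, of W] by metis
  then show ?thesis by (simp only:)
qed

lemma GP_large_stable_sets:
  assumes "Y \<subseteq> GP_verts r s t" "m \<ge> 3"
  shows "{W. W \<subseteq> Y \<and> card W = m \<and> stable_set (GP_edges r s t) W} =
    (if m = 3 \<and> {Apex_a, Apex_b, Apex_c} \<subseteq> Y then {{Apex_a, Apex_b, Apex_c}} else {})"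
proof -
  have "W = {Apex_a, Apex_b, Apex_c} \<and> m = 3"
    if W: "W \<subseteq> Y" "card W = m" "stable_set (GP_edges r s t) W" for W
  proof -
    have "W \<subseteq> {Apex_a, Apex_b, Apex_c}"
    proof (rule ccontr)
      assume "\<not> ?thesis"
      then obtain P where P: "P \<in> GP_pendant_pairs r s t" "W \<subseteq> P"
        using W assms(1) GP_stable_sets[of W r s t] by blast
      then have "card P = 2" "finite P" by (auto simp: GP_pendant_pairs_def)
      then show False using card_mono[of P W] P W(2) assms(2) by simp
    qed
    moreover have "card {Apex_a, Apex_b, Apex_c} = 3" by simp
    ultimately show ?thesis
      using card_mono[of "{Apex_a, Apex_b, Apex_c}" W] card_subset_eq[of "{Apex_a, Apex_b, Apex_c}" W]
        W(2) assms(2) by simp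
  qed
  moreover have "stable_set (GP_edges r s t) {Apex_a, Apex_b, Apex_c}"
    using GP_stable_sets by blast
  ultimately show ?thesis by auto
qed

text \<open>Ordered matchings of the triangle with \<open>t\<close>, \<open>s\<close>, \<open>r\<close> pendant edges at its corners, of which only
  those marked by the truth values are still free. A used corner takes all its pendant edges out of
  play, so no other information about the earlier edges of a matching is needed.\<close>

primrec apex_matchings :: "nat \<Rightarrow> nat \<Rightarrow> nat \<Rightarrow> nat \<Rightarrow> bool \<Rightarrow> bool \<Rightarrow> bool \<Rightarrow> nat" where
  "apex_matchings 0 r s t \<alpha> \<beta> \<gamma> = 1"
| "apex_matchings (Suc k) r s t \<alpha> \<beta> \<gamma> =
     (if \<alpha> \<and> \<beta> then apex_matchings k r s t False False \<gamma> else 0) +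
     (if \<alpha> \<and> \<gamma> then apex_matchings k r s t False \<beta> False else 0) +
     (if \<beta> \<and> \<gamma> then apex_matchings k r s t \<alpha> False False else 0) +
     (if \<alpha> then t * apex_matchings k r s t False \<beta> \<gamma> else 0) +
     (if \<beta> then s * apex_matchings k r s t \<alpha> False \<gamma> else 0) +
     (if \<gamma> then r * apex_matchings k r s t \<alpha> \<beta> False else 0)"

text \<open>The last three assumptions allow pendant vertices to be missing only where their apex is missing.
  Deleting an edge of the complement preserves this, and so the free apices alone determine the count.\<close>

lemma ordered_matchings_GP:
  assumes "Y \<subseteq> GP_verts r s t"
    and "Apex_a \<in> Y \<Longrightarrow> BC ` {..<t} \<subseteq> Y"
    and "Apex_b \<in> Y \<Longrightarrow> AC ` {..<s} \<subseteq> Y"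
    and "Apex_c \<in> Y \<Longrightarrow> AB ` {..<r} \<subseteq> Y"
  shows "ordered_matchings k (GP_edges r s t) Y =
    apex_matchings k r s t (Apex_a \<in> Y) (Apex_b \<in> Y) (Apex_c \<in> Y)"
  using assms
proof (induction k arbitrary: Y)
  case (Suc k)
  let ?F = "\<lambda>W. ordered_matchings k (GP_edges r s t) (Y - W)"
  let ?G = "\<lambda>W. if W \<subseteq> Y then ?F W else 0"
  let ?A = "(\<lambda>i. {Apex_a, BC i}) ` {..<t}"
  let ?B = "(\<lambda>i. {Apex_b, AC i}) ` {..<s}"
  let ?C = "(\<lambda>i. {Apex_c, AB i}) ` {..<r}"
  let ?T = "{{Apex_a, Apex_b}, {Apex_a, Apex_c}, {Apex_b, Apex_c}}"
  have IH: "?F W = apex_matchings k r s t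
      (Apex_a \<in> Y - W) (Apex_b \<in> Y - W) (Apex_c \<in> Y - W)"
    if "W \<in> ?T \<union> ?A \<union> ?B \<union> ?C" for W
  proof (rule Suc.IH)
    \<comment> \<open>a pendant vertex is only ever removed together with its apex\<close>
    have W: "BC i \<in> W \<Longrightarrow> Apex_a \<in> W" "AC i \<in> W \<Longrightarrow> Apex_b \<in> W" "AB i \<in> W \<Longrightarrow> Apex_c \<in> W" for i
      using that by auto
    show "Y - W \<subseteq> GP_verts r s t" using Suc.prems(1) by blast
    show "BC ` {..<t} \<subseteq> Y - W" if "Apex_a \<in> Y - W" using that W(1) Suc.prems(2) by blast
    show "AC ` {..<s} \<subseteq> Y - W" if "Apex_b \<in> Y - W" using that W(2) Suc.prems(3) by blast
    show "AB ` {..<r} \<subseteq> Y - W" if "Apex_c \<in> Y - W" using that W(3) Suc.prems(4) by blast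
  qed
  have "ordered_matchings (Suc k) (GP_edges r s t) Y =
      (\<Sum>W | W \<in> ?T \<union> ?A \<union> ?B \<union> ?C \<and> W \<subseteq> Y. ?F W)"
    unfolding ordered_matchings.simps GP_stable_pairs[OF Suc.prems(1)] GP_pendant_pairs_def
    by (simp add: Un_assoc)
  also have "\<dots> = (\<Sum>W \<in> ?T \<union> ?A \<union> ?B \<union> ?C. ?G W)"
    by (rule sum.inter_filter) simp
  also have "\<dots> = sum ?G ?T + sum ?G ?A + sum ?G ?B + sum ?G ?C"
  proof -
    have "?T \<inter> ?A = {}" "(?T \<union> ?A) \<inter> ?B = {}" "(?T \<union> ?A \<union> ?B) \<inter> ?C = {}"
      by (auto simp: doubleton_eq_iff)
    then show ?thesis by (simp only: sum.union_disjoint finite_UnI finite_imageI finite_lessThan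
          finite_insert finite.emptyI)
  qed
  also have "sum ?G ?T = ?G {Apex_a, Apex_b} + ?G {Apex_a, Apex_c} + ?G {Apex_b, Apex_c}"
    by (simp add: doubleton_eq_iff)
  also have "sum ?G ?A = (\<Sum>i<t. ?G {Apex_a, BC i})"
    by (subst sum.reindex) (auto simp: inj_on_def doubleton_eq_iff)
  also have "\<dots> = (if Apex_a \<in> Y then
      t * apex_matchings k r s t False (Apex_b \<in> Y) (Apex_c \<in> Y) else 0)"
  proof -
    have "?G {Apex_a, BC i} = (if Apex_a \<in> Y then apex_matchings k r s t False (Apex_b \<in> Y) (Apex_c \<in> Y) else 0)"
      if "i < t" for i
      using Suc.prems(2) that by (subst IH) auto
    then show ?thesis by simp
  qed
  also have "sum ?G ?B = (\<Sum>i<s. ?G {Apex_b, AC i})"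
    by (subst sum.reindex) (auto simp: inj_on_def doubleton_eq_iff)
  also have "\<dots> = (if Apex_b \<in> Y then
      s * apex_matchings k r s t (Apex_a \<in> Y) False (Apex_c \<in> Y) else 0)"
  proof -
    have "?G {Apex_b, AC i} = (if Apex_b \<in> Y then apex_matchings k r s t (Apex_a \<in> Y) False (Apex_c \<in> Y) else 0)"
      if "i < s" for i
      using Suc.prems(3) that by (subst IH) auto
    then show ?thesis by simp
  qed
  also have "sum ?G ?C = (\<Sum>i<r. ?G {Apex_c, AB i})"
    by (subst sum.reindex) (auto simp: inj_on_def doubleton_eq_iff)
  also have "\<dots> = (if Apex_c \<in> Y then
      r * apex_matchings k r s t (Apex_a \<in> Y) (Apex_b \<in> Y) False else 0)"
  proof -
    have "?G {Apex_c, AB i} = (if Apex_c \<in> Y then apex_matchings k r s t (Apex_a \<in> Y) (Apex_b \<in> Y) False else 0)"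
      if "i < r" for i
      using Suc.prems(4) that by (subst IH) auto
    then show ?thesis by simp
  qed
  finally show ?case by (simp add: IH)
qed simp

lemma apex_matchings_none: "k > 0 \<Longrightarrow> apex_matchings k r s t False False False = 0"
  by (cases k) auto

lemma apex_matchings_one:
  assumes "k > 1"
  shows "apex_matchings k r s t True False False = 0" "apex_matchings k r s t False True False = 0"
    "apex_matchings k r s t False False True = 0"
  using assms by (cases k; simp add: apex_matchings_none)+

lemma apex_matchings_two:
  assumes "k > 2"
  shows "apex_matchings k r s t True True False = 0" "apex_matchings k r s t False True True = 0"
    "apex_matchings k r s t True False True = 0"
  using assms by (cases k; simp add: apex_matchings_none apex_matchings_one)+

lemma apex_matchings_three: "k > 3 \<Longrightarrow> apex_matchings k r s t True True True = 0"
  by (cases k) (simp_all add: apex_matchings_two apex_matchings_one)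

lemma apex_matchings_values:
  "apex_matchings 1 r s t True True True = r + s + t + 3"
  "apex_matchings 2 r s t True True True = 2 * (r * s + r * t + s * t) + 2 * (r + s + t)"
  "apex_matchings 3 r s t True True True = 6 * (r * s * t)"
proof -
  show "apex_matchings 1 r s t True True True = r + s + t + 3"
    by simp
  have "apex_matchings (Suc 1) r s t True True True =
      r + s + t + t * (s + r + 1) + s * (t + r + 1) + r * (t + s + 1)"
    by simp
  then show "apex_matchings 2 r s t True True True = 2 * (r * s + r * t + s * t) + 2 * (r + s + t)"
    unfolding Suc_1 by (simp add: algebra_simps)
  have "apex_matchings (Suc (Suc 1)) r s t True True True =
      t * (s * r + r * s) + s * (t * r + r * t) + r * (t * s + s * t)"
    by simp
  then show "apex_matchings 3 r s t True True True = 6 * (r * s * t)"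
    unfolding Suc_1 Suc_numeral by (simp add: algebra_simps)
qed

lemma ordered_matchings_GP_verts:
  "ordered_matchings k (GP_edges r s t) (GP_verts r s t) = 
    (if k = 0 then 1 else if k = 1 then r + s + t + 3 else
     if k = 2 then 2 * (r * s + r * t + s * t) + 2 * (r + s + t) else
     if k = 3 then 6 * (r * s * t) else 0)"
proof -
  have "ordered_matchings k (GP_edges r s t) (GP_verts r s t) = apex_matchings k r s t True True True"
    by (subst ordered_matchings_GP) (auto simp: GP_verts_def)
  then show ?thesis
    using apex_matchings_three[of k r s t] apex_matchings_values[of r s t] by auto
qed

lemma finite_GP_verts: "finite (GP_verts r s t)"
  by (simp add: GP_verts_def)

section \<open>The expansion of the chromatic symmetric function\<close>

lemma real_choose_two: "real (n choose 2) = real n * (real n - 1) / 2"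
  by (induction n) (simp_all add: numeral_2_eq_2 field_simps)

lemma real_choose_three: "real (n choose 3) = real n * (real n - 1) * (real n - 2) / 6"
proof (induction n)
  case (Suc n)
  have "Suc n choose 3 = (n choose 2) + (n choose 3)"
    by (simp add: numeral_3_eq_3 numeral_2_eq_2)
  then show ?case using Suc by (simp add: real_choose_two field_simps)
qed simp

text \<open>The coefficients in the expansion below are obtained by solving the triangular system of
  \<open>coeff_identities\<close> from bottom to top. Here \<open>N\<close>, \<open>p\<close>, \<open>q\<close> stand for the elementary symmetric
  polynomials \<open>r + s + t\<close>, \<open>r s + r t + s t\<close>, \<open>r s t\<close>. The truncated subtractions are harmless:
  where one of them truncates, the expression in \<open>p\<close> and \<open>q\<close> that it multiplies vanishes.\<close>

definition coeff_n :: "nat \<Rightarrow> real \<Rightarrow> real \<Rightarrow> real" where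
  "coeff_n N p q = real (N + 3) * fact (N - 1) * (real N * p - q)"

definition coeff_n1 :: "nat \<Rightarrow> real \<Rightarrow> real \<Rightarrow> real" where
  "coeff_n1 N p q = fact N * real (N * (N + 2)) - 2 * real (N + 1) * fact (N - 1) * p
     + 3 * real (N + 1) * fact (N - 2) * q"

definition coeff_n2 :: "nat \<Rightarrow> real \<Rightarrow> real \<Rightarrow> real" where
  "coeff_n2 N p q = 2 * fact (N - 1) * p - 6 * real (N - 1) * fact (N - 3) * q"

text \<open>The three identities compare coefficients at the monomials with no, one and two doubled
  variables. With \<open>N + 3\<close> variables in all, counted with multiplicity, these have \<open>N + 3\<close>, \<open>N + 1\<close> and
  \<open>N - 1\<close> simple variables, and the left-hand sides are the numbers of ordered matchings times the
  factorials of these numbers.\<close>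

lemma coeff_identities:
  assumes "N < 2 \<Longrightarrow> p = 0" "N < 3 \<Longrightarrow> q = 0"
  shows "fact (N + 3) = coeff_n N p q + coeff_n1 N p q * real (N + 3) +
      coeff_n2 N p q * real (N + 3 choose 2) + 6 * fact (N - 3) * q * real (N + 3 choose 3) +
      fact N * real ((N + 3) * (N + 2))" (is ?zero)
    and "real (N + 3) * fact (N + 1) = coeff_n1 N p q + coeff_n2 N p q * real (N + 1) +
      6 * fact (N - 3) * q * real (N + 1 choose 2) + fact N * (2 * real (N + 1) + 1)" (is ?one)
    and "N \<ge> 1 \<Longrightarrow> (2 * p + 2 * real N) * fact (N - 1) =
      coeff_n2 N p q + 6 * fact (N - 3) * q * real (N - 1) + 2 * fact N" (is "_ \<Longrightarrow> ?two")
proof -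
  consider "N = 0" | "N = 1" | "N = 2" | m where "N = m + 3"
    by (metis One_nat_def Suc_1 add.commute le_Suc_ex not_less_eq_eq numeral_3_eq_3 le_0_eq le_SucE)
  then have "?zero \<and> ?one \<and> (N \<ge> 1 \<longrightarrow> ?two)"
  proof cases
    case (4 m)
    define f :: real where "f = fact m"
    have facts: "fact (m + 3 - 3) = f" "fact (m + 3 - 2) = (real m + 1) * f"
      "fact (m + 3 - 1) = (real m + 2) * (real m + 1) * f"
      "fact (m + 3) = (real m + 3) * (real m + 2) * (real m + 1) * f"
      "fact (m + 3 + 1) = (real m + 4) * (real m + 3) * (real m + 2) * (real m + 1) * f"
      "fact (m + 3 + 3) = (real m + 6) * (real m + 5) * (real m + 4) * (real m + 3) * (real m + 2) * (real m + 1) * f"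
      by (simp_all add: f_def numeral_3_eq_3 numeral_2_eq_2 algebra_simps)
    have chooses: "real (m + 3 + 3 choose 2) = (real m + 6) * (real m + 5) / 2"
      "real (m + 3 + 3 choose 3) = (real m + 6) * (real m + 5) * (real m + 4) / 6"
      "real (m + 3 + 1 choose 2) = (real m + 4) * (real m + 3) / 2"
      unfolding real_choose_two real_choose_three by (simp_all add: field_simps)
    have minus: "real (m + 3 - 1) = real m + 2" by simp
    show ?thesis
      unfolding 4 coeff_n_def coeff_n1_def coeff_n2_def facts chooses minus
      by (simp add: field_simps)
  qed (use assms in \<open>auto simp: coeff_n_def coeff_n1_def coeff_n2_def fact_numeral
      numeral_2_eq_2 numeral_3_eq_3\<close>)
  then show ?zero ?one "N \<ge> 1 \<Longrightarrow> ?two" by auto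
qed

text \<open>The first two bounds come from \<open>q \<le> N p\<close> and \<open>3 p \<le> N\<^sup>2\<close>. The third one needs
  \<open>3 q \<le> (N - 2) p\<close>, which can fail for real numbers and uses integrality: it is trivial if one of
  \<open>r\<close>, \<open>s\<close>, \<open>t\<close> is 0, and otherwise all three are at least 1.\<close>

lemma coeffs_nonneg:
  fixes r s t :: nat
  defines "N \<equiv> r + s + t" and "p \<equiv> real (r * s + r * t + s * t)" and "q \<equiv> real (r * s * t)"
  shows "coeff_n N p q \<ge> 0" "coeff_n1 N p q \<ge> 0" "coeff_n2 N p q \<ge> 0"
proof -
  have nonneg: "p \<ge> 0" "q \<ge> 0" by (simp_all add: p_def q_def)
  have "q \<le> real N * p"
    unfolding N_def p_def q_def by (simp add: algebra_simps)
  then show "coeff_n N p q \<ge> 0" by (simp add: coeff_n_def)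
  have "3 * p \<le> real N ^ 2"
  proof -
    have "0 \<le> (real r - real s) ^ 2 + (real r - real t) ^ 2 + (real s - real t) ^ 2" by simp
    then show ?thesis unfolding p_def N_def by (simp add: power2_eq_square algebra_simps)
  qed
  then have "2 * real (N + 1) * (3 * p) \<le> 2 * real (N + 1) * real N ^ 2"
    by (intro mult_left_mono) auto
  also have "\<dots> \<le> 3 * (real N ^ 2 * real (N + 2))"
    by (simp add: algebra_simps power2_eq_square)
  finally have p_le: "2 * real (N + 1) * p \<le> real N ^ 2 * real (N + 2)" by simp
  have "fact N * real (N * (N + 2)) = fact (N - 1) * (real N ^ 2 * real (N + 2))"
    by (cases N) (simp_all add: power2_eq_square algebra_simps)
  then have "coeff_n1 N p q = fact (N - 1) * (real N ^ 2 * real (N + 2) - 2 * real (N + 1) * p) +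
      3 * real (N + 1) * fact (N - 2) * q"
    by (simp add: coeff_n1_def algebra_simps)
  then show "coeff_n1 N p q \<ge> 0" using p_le nonneg by simp
  show "coeff_n2 N p q \<ge> 0"
  proof (cases "r = 0 \<or> s = 0 \<or> t = 0")
    case True
    then have "q = 0" by (auto simp: q_def)
    then show ?thesis using nonneg by (simp add: coeff_n2_def)
  next
    case False
    then obtain a b c where abc: "r = Suc a" "s = Suc b" "t = Suc c"
      by (metis not0_implies_Suc)
    define m where "m = a + b + c"
    have N: "N = m + 3" by (simp add: N_def m_def abc)
    \<comment> \<open>after expansion in \<open>a\<close>, \<open>b\<close>, \<open>c\<close> every monomial on the left is dominated on the right\<close>
    have "3 * (r * s * t) \<le> (m + 1) * (r * s + r * t + s * t)"
      unfolding abc m_def by (simp add: algebra_simps)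
    then have "real (3 * (r * s * t)) \<le> real ((m + 1) * (r * s + r * t + s * t))"
      by (simp only: of_nat_le_iff)
    then have "3 * q \<le> (real m + 1) * p" by (simp add: p_def q_def algebra_simps)
    moreover have "coeff_n2 N p q = 2 * (real m + 2) * fact m * ((real m + 1) * p - 3 * q)"
      unfolding N coeff_n2_def by (simp add: numeral_3_eq_3 numeral_2_eq_2 algebra_simps)
    ultimately show ?thesis by simp
  qed
qed

lemma GP_coeff_doubles:
  assumes "finite D" "finite U" "D \<inter> U = {}" "0 \<notin> D \<union> U" "2 * card D + card U = r + s + t + 3"
  shows "chromatic_symmetric_function (GP r s t) (mset_set D + mset_set D + mset_set U) =
    real (ordered_matchings (card D) (GP_edges r s t) (GP_verts r s t)) * fact (card U)"
proof -
  have "card (colorings_of (GP_edges r s t) (GP_verts r s t) (mset_set D + mset_set D + mset_set U)) =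
      ordered_matchings (card D) (GP_edges r s t) (GP_verts r s t) * fact (card U)"
    using assms GP_no_loop
    by (intro card_colorings_of_doubles) (auto simp: finite_GP_verts card_GP_verts)
  moreover have "0 \<notin># mset_set D + mset_set D + mset_set U" using assms by auto
  ultimately show ?thesis
    unfolding GP_def
    using chromatic_symmetric_function_coeff[OF finite_simple_graph_GP[of r s t, unfolded GP_def]]
    by simp
qed

text \<open>A color used at least three times must be used on exactly the three apices. Every other stable set
  with more than one element contains an apex, so no second color can be repeated.\<close>

lemma GP_coeff_multiplicity_ge_3:
  assumes "m \<ge> 3" "d \<notin># M" "0 \<notin># add_mset d M" "m + size M = r + s + t + 3"
  shows "chromatic_symmetric_function (GP r s t) (replicate_mset m d + M) =
    (if m = 3 \<and> (\<forall>x. count M x \<le> 1) then fact (r + s + t) else 0)"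
proof -
  let ?V = "GP_verts r s t" and ?E = "GP_edges r s t" and ?T = "{Apex_a, Apex_b, Apex_c}"
  have T: "?T \<subseteq> ?V" by (simp add: GP_verts_def)
  have card_rest: "card (?V - ?T) = r + s + t"
    using T by (subst card_Diff_subset) (simp_all add: card_GP_verts)
  have "card (colorings_of ?E ?V (replicate_mset m d + M)) =
      (if m = 3 then card (colorings_of ?E (?V - ?T) M) else 0)"
    unfolding colorings_of_color_class[OF finite_GP_verts assms(2)]
    using T by (simp only: GP_large_stable_sets[OF order_refl assms(1)]) auto
  also have "\<dots> = (if m = 3 \<and> (\<forall>x. count M x \<le> 1) then fact (r + s + t) else 0)"
  proof (cases "m = 3 \<and> (\<forall>x. count M x \<le> 1)")
    case True
    then have M: "M = mset_set (set_mset M)" by (metis squarefree_iff)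
    have "card (set_mset M) = r + s + t" using assms(4) True M by (metis add.commute add_left_cancel size_mset_set)
    then have "card (colorings_of ?E (?V - ?T) (mset_set (set_mset M))) = fact (r + s + t)"
      using card_colorings_of_squarefree[of "set_mset M" "?V - ?T" ?E] card_rest GP_no_loop
      by (simp add: finite_GP_verts)
    then show ?thesis using True M by simp
  next
    case False
    have "card (colorings_of ?E (?V - ?T) M) = 0" if "m = 3"
    proof -
      have "\<exists>d'. \<not> count M d' \<le> 1" using False that by blast
      then obtain d' where "\<not> count M d' \<le> 1" ..
      then have d': "count M d' \<ge> 2" by simp
      define M' where "M' = filter_mset (\<lambda>x. x \<noteq> d') M"
      have M: "M = replicate_mset (count M d') d' + M'"
        by (auto simp: M'_def multiset_eq_iff)
      have none: "{W. W \<subseteq> ?V - ?T \<and> card W = count M d' \<and> stable_set ?E W} = {}"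
      proof (cases "count M d' = 2")
        case True
        show ?thesis
        proof -
          have meets: "W \<inter> ?T \<noteq> {}"
            if "W \<in> {{Apex_a, Apex_b}, {Apex_a, Apex_c}, {Apex_b, Apex_c}} \<union> GP_pendant_pairs r s t" for W
            using that unfolding GP_pendant_pairs_def by (elim UnE insertE imageE emptyE) simp_all
          have "{W. W \<subseteq> ?V - ?T \<and> card W = 2 \<and> stable_set ?E W} = {}"
            unfolding GP_stable_pairs[of "?V - ?T" r s t, OF Diff_subset] using meets by fast
          then show ?thesis using True by simp
        qed
      next
        case False
        then show ?thesis
          using d' GP_large_stable_sets[of "?V - ?T" r s t "count M d'"] by auto
      qed
      have absent: "d' \<notin># M'" by (simp add: M'_def)
      have "card (colorings_of ?E (?V - ?T) (replicate_mset (count M d') d' + M')) = 0"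
        unfolding colorings_of_color_class[OF finite_Diff[OF finite_GP_verts] absent] none by simp
      then show ?thesis by (simp only: M[symmetric])
    qed
    then show ?thesis using False by auto
  qed
  finally show ?thesis
    using chromatic_symmetric_function_coeff[OF finite_simple_graph_GP[of r s t, unfolded GP_def],
        of "replicate_mset m d + M"] assms
    by (simp add: GP_def)
qed

text \<open>At monomials with exponents at most 2 this is the linear system solved above, together with the
  immediate comparison for three doubled variables. At a monomial \<open>x\<^sup>3\<close> times \<open>N\<close> simple variables only the last
  summand contributes on the right.\<close>

theorem chromatic_symmetric_function_GP:
  fixes r s t :: nat
  defines "N \<equiv> r + s + t" and "p \<equiv> real (r * s + r * t + s * t)" and "q \<equiv> real (r * s * t)"
  shows "chromatic_symmetric_function (GP r s t) = (\<lambda>M.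
    coeff_n N p q * elem_sym_list [N + 3] M +
    coeff_n1 N p q * elem_sym_list [1, N + 2] M +
    coeff_n2 N p q * elem_sym_list [2, N + 1] M +
    6 * fact (N - 3) * q * elem_sym_list [3, N] M +
    fact N * elem_sym_list [1, 1, N + 1] M)" (is "?X = ?R")
proof
  fix M
  have small: "N < 2 \<Longrightarrow> p = 0" "N < 3 \<Longrightarrow> q = 0"
    by (cases r; cases s; cases t; simp add: N_def p_def q_def)+
  note lists = elem_sym_list_Cons elem_sym_list_Nil series_mult_one_right
  show "?X M = ?R M"
  proof (cases "0 \<notin># M \<and> size M = N + 3")
    case False
    have "?X M = 0"
      using False chromatic_symmetric_function_nonzeroD[OF finite_GP_verts, of r s t "GP_edges r s t" M]
      by (auto simp: GP_def card_GP_verts N_def)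
    moreover have "elem_sym_list l M = 0" if "sum_list l = N + 3" for l
      using elem_sym_list_nonzeroD[of l M] False that by auto
    ultimately show ?thesis by simp
  next
    case M: True
    show ?thesis
    proof (cases "\<forall>x. count M x \<le> 2")
      case True
      define D where "D = {x. count M x = 2}"
      define U where "U = {x. count M x = 1}"
      have fin: "finite D" "finite U"
        by (auto simp: D_def U_def intro!: finite_subset[OF _ finite_set_mset[of M]]
            simp flip: count_greater_zero_iff)
      have disj: "D \<inter> U = {}" by (auto simp: D_def U_def)
      have eq: "M = mset_set D + mset_set D + mset_set U"
      proof (rule multiset_eqI)
        fix x
        have "count M x \<le> 2" using True by blast
        then consider "count M x = 0" | "count M x = 1" | "count M x = 2" by linarith
        then show "count M x = count (mset_set D + mset_set D + mset_set U) x"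
          using fin by cases (simp_all add: count_mset_set' D_def U_def)
      qed
      have zero: "0 \<notin> D \<union> U" using M eq fin by auto
      have size: "2 * card D + card U = N + 3" using M eq by simp
      have sizes: "2 * card D + card U = k + l" if "k + l = N + 3" for k l
        using size that by simp
      have X: "?X M = real (ordered_matchings (card D) (GP_edges r s t) (GP_verts r s t)) * fact (card U)"
        unfolding eq using GP_coeff_doubles[OF fin disj zero] size by (simp add: N_def)
      have two: "elem_sym_list [k, l] M =
          (if card D \<le> k then real (card U choose (k - card D)) else 0)" if "k + l = N + 3" for k l
        unfolding lists eq using elem_sym_elem_sym_coeff[OF fin(2,1) disj zero, of k l] sizes that
        by simp
      have three: "elem_sym_list [1, 1, N + 1] M =
          (if card D = 0 then real (card U * (card U - 1)) else
           if card D = 1 then 2 * real (card U) + 1 else if card D = 2 then 2 else 0)"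
        unfolding lists eq using elem_sym_1_1_coeff[OF fin(2,1) disj zero, of "N + 1"] size by simp
      have one: "elem_sym_list [N + 3] M = of_bool (card D = 0)"
      proof -
        have "count M x \<le> 1 \<longleftrightarrow> x \<notin> D" for x
          using True[rule_format, of x] unfolding D_def mem_Collect_eq by arith
        then have "(\<forall>x. count M x \<le> 1) \<longleftrightarrow> card D = 0" using fin(1) by auto
        then show ?thesis using M unfolding lists elem_sym_eq by simp
      qed
      note ids = coeff_identities[of N p q, OF small]
      consider "card D = 0" | "card D = 1" | "card D = 2" | "card D = 3" | "card D > 3" by linarith
      then show ?thesis
      proof cases
        case 1
        then have "card U = N + 3" using size by simp
        then show ?thesis
          using ids(1) 1 unfolding X one three by (simp add: two ordered_matchings_GP_verts)
      next
        case 2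
        then have "card U = N + 1" using size by simp
        then show ?thesis
          using ids(2) 2 unfolding X one three
          by (simp add: two ordered_matchings_GP_verts N_def)
      next
        case 3
        then have "card U = N - 1" "N \<ge> 1" using size by simp_all
        then show ?thesis
          using ids(3) 3 unfolding X one three
          by (simp add: two ordered_matchings_GP_verts N_def p_def)
      next
        case 4
        then have "card U = N - 3" "N \<ge> 3" using size by simp_all
        then show ?thesis
          using 4 unfolding X one three
          by (simp add: two ordered_matchings_GP_verts q_def)
      next
        case 5
        then show ?thesis
          unfolding X one three by (simp add: two ordered_matchings_GP_verts)
      qed
    next
      case False
      then obtain d where "\<not> count M d \<le> 2" by blast
      then have d: "count M d \<ge> 3" by simp
      define M' where "M' = filter_mset (\<lambda>x. x \<noteq> d) M"
      have eq: "M = replicate_mset (count M d) d + M'"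
        by (auto simp: M'_def multiset_eq_iff)
      have M': "d \<notin># M'" "0 \<notin># add_mset d M'" "count M d + size M' = r + s + t + 3"
      proof -
        show "d \<notin># M'" by (simp add: M'_def)
        have "d \<in># M" using d by (metis count_eq_zero_iff not_numeral_le_zero)
        then show "0 \<notin># add_mset d M'" using M by (cases "d = 0") (auto simp: M'_def)
        show "count M d + size M' = r + s + t + 3"
          using M arg_cong[OF eq, of size] by (simp add: N_def)
      qed
      have X: "?X M = (if count M d = 3 \<and> (\<forall>x. count M' x \<le> 1) then fact N else 0)"
        by (subst eq) (use GP_coeff_multiplicity_ge_3[OF d M'] in \<open>simp add: N_def\<close>)
      have two: "elem_sym_list [k, l] M = 0" for k l
        unfolding lists using d by (rule elem_sym_elem_sym_eq_0)
      have one: "elem_sym_list [N + 3] M = 0"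
        unfolding lists elem_sym_eq using d by (auto intro!: exI[of _ d])
      have three: "elem_sym_list [1, 1, N + 1] M =
          (if count M d = 3 \<and> (\<forall>x. count M' x \<le> 1) then 1 else 0)"
      proof (cases "count M d = 3 \<and> (\<forall>x. count M' x \<le> 1)")
        case True
        then have sqf: "M' = mset_set (set_mset M')" by (metis squarefree_iff)
        have "M = replicate_mset 3 d + mset_set (set_mset M')"
          using True eq sqf by simp
        moreover have "card (set_mset M') = N"
          using M'(3) True sqf by (metis N_def add.commute add_left_cancel size_mset_set)
        ultimately show ?thesis
          using M' True elem_sym_1_1_coeff_triple[of "set_mset M'" d "N + 1"] unfolding lists by simp
      next
        case False
        have "elem_sym_list [1, 1, N + 1] M = 0"
        proof (rule ccontr)
          assume "elem_sym_list [1, 1, N + 1] M \<noteq> 0"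
          then obtain x y B where B: "M = {#x#} + {#y#} + B" "\<And>z. count B z \<le> 1"
            unfolding lists by (rule elem_sym_1_1_nonzeroD) blast
          define c where "c = count B d"
          have "count M d = of_bool (x = d) + of_bool (y = d) + c" by (simp add: B(1) c_def)
          moreover have "c \<le> 1" unfolding c_def by (rule B(2))
          ultimately have "x = d \<and> y = d \<and> count M d = 3"
            using d by (cases "x = d"; cases "y = d"; simp)
          then have xy: "x = d" "y = d" and "count M d = 3" by auto
          moreover have "count M' z \<le> 1" for z
            using B(2)[of z] by (cases "z = d") (simp_all add: M'_def B(1) xy)
          ultimately show False using False by blast
        qed
        then show ?thesis using False by simp
      qed
      show ?thesis unfolding X one two three by simp
    qed
  qed
qed

theorem theorem2p5:
  fixes r s t :: nat
  shows "e_positive (GP r s t)"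
proof -
  have "e_cone (r + s + t + 3) (chromatic_symmetric_function (GP r s t))"
    unfolding chromatic_symmetric_function_GP
    by (intro e_cone_add e_cone_scale e_cone_elem_sym_list coeffs_nonneg mult_nonneg_nonneg) simp_all
  then show ?thesis by (simp add: e_positive_def e_cone_def GP_def card_GP_verts)
qed

end
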